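(* There exists $t_0>1$ such that for every $t\ge t_0$ the following holds. Let $h^*$ be the non-negative solution of $$\frac{d^2h}{dr^2}+\frac2r\frac{dh}{dr}-\frac{6h}{r^2}=-h+h^3+\frac{3h_+}{t}\left(h^3-h^2\right),\quad r\in(0,\infty),\qquad h(0)=0,\quad h(r)\to1\text{ as }r\to\infty .$$ Then $h^*$ is monotonically increasing on $(0,\infty)$.
   Context: Here $h_+=\frac{3+\sqrt{9+8t}}{4}$, where $t$ is a real parameter (reduced temperature). The function $h^*$ is the scalar order parameter of the radial-hedgehog solution $\mathbf{Q}^*=\sqrt{3/2}\,h^*(r)\left(\frac{\mathbf{r}\otimes\mathbf{r}}{r^2}-\frac13\mathbf{I}\right)$, considered in the limit $t\to\infty$, in which the rescaled domain is unbounded. *)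

theory Defs
  imports Complex_Main
begin

definition h_plus :: "real \<Rightarrow> real" where
  "h_plus t = (3 + sqrt (9 + 8 * t)) / 4"

text \<open>
  Classical non-negative solutions of the boundary-value problem for the scalar order parameter
  of the radial hedgehog on the whole half-line. The equation is singular at the origin, so it is
  imposed on the open half-line only, and the condition at \<open>0\<close> is linked to the equation by
  right-continuity there. The values of \<open>h\<close> on the negative axis are irrelevant.
\<close>

definition hedgehog_profile :: "real \<Rightarrow> (real \<Rightarrow> real) \<Rightarrow> bool" where
  "hedgehog_profile t h \<longleftrightarrow>
     (\<exists>h' h''. \<forall>r>0.
        (h has_real_derivative h' r) (at r) \<and>
        (h' has_real_derivative h'' r) (at r) \<and>
        h'' r + 2 / r * h' r - 6 * h r / r\<^sup>2
          = - h r + h r ^ 3 + 3 * h_plus t / t * (h r ^ 3 - h r ^ 2)) \<and>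
     (\<forall>r\<ge>0. h r \<ge> 0) \<and>
     h 0 = 0 \<and> (h \<longlongrightarrow> h 0) (at_right 0) \<and>
     (h \<longlongrightarrow> 1) at_top"

end

theory Submission
  imports Defs
begin

text \<open>
  Write \<open>a = 3 h\<^sub>+ / t\<close>; the equation reads \<open>h'' + 2 h' / r = (6 / r\<^sup>2 + G h) h\<close> with
  \<open>G x = (1 + a) x\<^sup>2 - a x - 1\<close>. A local maximum at \<open>r\<^sub>1\<close> and a later, lower local
  minimum at \<open>r\<^sub>2\<close> would give \<open>G (h r\<^sub>1) \<le> - 6 / r\<^sub>1\<^sup>2 < - 6 / r\<^sub>2\<^sup>2 \<le> G (h r\<^sub>2)\<close>.
  This is impossible when \<open>G\<close> is increasing on \<open>[h r\<^sub>2, h r\<^sub>1]\<close>. For \<open>r\<^sub>2\<^sup>2 > 6\<close> it is, since then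
  \<open>G (h r\<^sub>2) > - 1\<close> forces \<open>h r\<^sub>2 > a / (1 + a)\<close>. For \<open>r\<^sup>2 \<le> 6\<close> there is no critical point at all:
  comparing the Wronskian of \<open>h\<close> with \<open>w r = r\<^sup>2 - r\<^sup>4 / 13\<close> shows \<open>h' / h \<ge> w' / w > 0\<close>, because
  \<open>G \<ge> - 14 / 13\<close> for \<open>a \<le> 1 / 2\<close>, which holds for \<open>t \<ge> 27\<close>.
\<close>

section \<open>Second-derivative test\<close>

text \<open>If \<open>D > 0\<close>, then \<open>f'\<close> is positive just to the right of its
  zero \<open>x\<close>, and the mean value theorem yields a larger value of \<open>f\<close> there.
  Continuity of the second derivative is not assumed.\<close>

lemma second_derivative_at_local_max:
  fixes f f' :: "real \<Rightarrow> real"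
  assumes "e > 0"
    and f: "\<And>y. \<bar>y - x\<bar> < e \<Longrightarrow> (f has_real_derivative f' y) (at y)"
    and f': "(f' has_real_derivative D) (at x)"
    and max: "\<And>y. \<bar>y - x\<bar> < e \<Longrightarrow> f y \<le> f x"
  shows "f' x = 0" and "D \<le> 0"
proof -
  show crit: "f' x = 0"
    using DERIV_local_max[OF f[of x] \<open>e > 0\<close>] max \<open>e > 0\<close> by (simp add: abs_minus_commute)
  show "D \<le> 0"
  proof (rule ccontr)
    assume "\<not> D \<le> 0"
    then obtain d where d: "d > 0" "\<And>s. 0 < s \<Longrightarrow> s < d \<Longrightarrow> f' x < f' (x + s)"
      using DERIV_pos_inc_right[OF f'] by auto
    define s where "s = min d e / 2"
    have s: "0 < s" "s < d" "s < e" using d(1) \<open>e > 0\<close> by (auto simp: s_def)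
    obtain z where z: "x < z" "z < x + s" "f (x + s) - f x = (x + s - x) * f' z"
      using MVT2[of x "x + s" f f'] s f by auto
    have "f' z > 0" using d(2)[of "z - x"] z s crit by auto
    then have "f (x + s) > f x" using z(3) s by (simp add: algebra_simps)
    moreover have "f (x + s) \<le> f x" by (rule max) (use s in auto)
    ultimately show False by simp
  qed
qed

lemma second_derivative_at_local_min:
  fixes f f' :: "real \<Rightarrow> real"
  assumes "e > 0"
    and "\<And>y. \<bar>y - x\<bar> < e \<Longrightarrow> (f has_real_derivative f' y) (at y)"
    and "(f' has_real_derivative D) (at x)"
    and "\<And>y. \<bar>y - x\<bar> < e \<Longrightarrow> f x \<le> f y"
  shows "f' x = 0" and "D \<ge> 0"
  using second_derivative_at_local_max[of e x "\<lambda>y. - f y" "\<lambda>y. - f' y" "- D"] assms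
  by (auto intro!: DERIV_minus)

section \<open>Size of the coupling\<close>

lemma coupling_bounds:
  assumes "t \<ge> 27"
  shows "3 * h_plus t / t > 0" and "3 * h_plus t / t \<le> 1 / 2"
proof -
  have "3 + sqrt (9 + 8 * t) > 0" using assms by (intro add_pos_nonneg) auto
  then show "3 * h_plus t / t > 0" using assms unfolding h_plus_def
    by simp
  \<comment> \<open>The bound \<open>1 / 2\<close> amounts to
    \<open>sqrt (9 + 8 * t) \<le> (2 * t - 9) / 3\<close>; the squares differ by
    \<open>4 / 9 * t * (t - 27)\<close>, whence the threshold 27.\<close>
  have "9 + 8 * t \<le> ((2 * t - 9) / 3)\<^sup>2"
  proof -
    have "0 \<le> t * (t - 27)" using assms by simp
    then show ?thesis by (simp add: power2_eq_square algebra_simps)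
  qed
  then have "sqrt (9 + 8 * t) \<le> (2 * t - 9) / 3" using assms by (intro real_le_lsqrt) auto
  then show "3 * h_plus t / t \<le> 1 / 2" using assms unfolding h_plus_def
    by (simp add: field_simps)
qed

section \<open>The profile equation and its reaction term\<close>

locale hedgehog =
  fixes a :: real and h h' h'' :: "real \<Rightarrow> real"
  assumes a_pos: "a > 0" and a_le: "a \<le> 1 / 2"
    and deriv_h: "r > 0 \<Longrightarrow> (h has_real_derivative h' r) (at r)"
    and deriv_h': "r > 0 \<Longrightarrow> (h' has_real_derivative h'' r) (at r)"
    and ode: "r > 0 \<Longrightarrow> h'' r + 2 / r * h' r - 6 * h r / r\<^sup>2
               = - h r + h r ^ 3 + a * (h r ^ 3 - h r ^ 2)"
    and nonneg: "r \<ge> 0 \<Longrightarrow> h r \<ge> 0"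
    and zero: "h 0 = 0" and right_cont: "(h \<longlongrightarrow> h 0) (at_right 0)"
    and limit: "(h \<longlongrightarrow> 1) at_top"
begin

definition G :: "real \<Rightarrow> real" where
  "G x = (1 + a) * x\<^sup>2 - a * x - 1"

lemma h''_eq: "r > 0 \<Longrightarrow> h'' r = (6 / r\<^sup>2 + G (h r)) * h r - 2 / r * h' r"
  using ode[of r] unfolding G_def
  by (simp add: algebra_simps power2_eq_square power3_eq_cube)

text \<open>Completing the square gives at least \<open>- 1 - 1 / 16\<close>. The weaker constant is
  the one that the comparison function \<open>w\<close> produces.\<close>

lemma G_ge: "G x \<ge> - (14 / 13)"
proof -
  have "a\<^sup>2 \<le> (1 / 2)\<^sup>2" using a_pos a_le by (intro power_mono) auto
  then have "a\<^sup>2 \<le> 1 / 4" by (simp add: power_divide)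
  moreover have "G x = (x - a / 2)\<^sup>2 + a * x\<^sup>2 - a\<^sup>2 / 4 - 1"
    by (simp add: G_def power2_eq_square field_simps)
  moreover have "(x - a / 2)\<^sup>2 \<ge> 0" "a * x\<^sup>2 \<ge> 0" using a_pos by auto
  ultimately show ?thesis by linarith
qed

lemma G_le_0: "0 \<le> x \<Longrightarrow> x \<le> 1 \<Longrightarrow> G x \<le> 0"
proof -
  assume x: "0 \<le> x" "x \<le> 1"
  have "G x = (x - 1) * (1 + (1 + a) * x)"
    by (simp add: G_def power2_eq_square algebra_simps)
  also have "\<dots> \<le> 0" using x a_pos by (intro mult_nonpos_nonneg) auto
  finally show ?thesis .
qed

text \<open>On the half-line \<open>x \<ge> 0\<close> the value -1 is taken at 0 and at
  \<open>a / (1 + a)\<close>; exceeding it places \<open>x\<close> beyond the latter, hence past the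
  vertex of the parabola.\<close>

lemma G_strict_mono_above:
  assumes "0 \<le> x" "x < y" "G x > - 1"
  shows "G x < G y"
proof -
  have "x * ((1 + a) * x - a) > 0"
    using assms(3) by (simp add: G_def power2_eq_square algebra_simps)
  then have "(1 + a) * x - a > 0" using assms(1) by (simp add: zero_less_mult_iff)
  moreover have "(1 + a) * y > 0" using a_pos assms by auto
  ultimately have "(y - x) * ((1 + a) * y + ((1 + a) * x - a)) > 0"
    using assms by (intro mult_pos_pos) auto
  then show ?thesis by (simp add: G_def power2_eq_square algebra_simps)
qed

lemma continuous_on_h: "continuous_on {0..R} h"
proof (cases "R > 0")
  case True
  show ?thesis unfolding continuous_on_def
  proof
    fix x assume "x \<in> {0..R}"
    show "(h \<longlongrightarrow> h x) (at x within {0..R})"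
    proof (cases "x = 0")
      case True
      have "at (0::real) within {0..R} = at_right 0"
        using \<open>R > 0\<close> by (rule at_within_Icc_at_right)
      then show ?thesis using right_cont True by simp
    next
      case False
      then have "isCont h x" using deriv_h[of x] \<open>x \<in> _\<close> by (auto intro: DERIV_isCont)
      then show ?thesis
        unfolding isCont_def by (rule tendsto_within_subset) simp
    qed
  qed
next
  case False
  then have "{0..R} = {} \<or> {0..R} = {0}" by auto
  then show ?thesis by auto
qed

section \<open>Extrema and a priori bounds\<close>

text \<open>At a critical point the first-order term vanishes, so the sign of \<open>h''\<close>
  passes to the reaction term.\<close>

lemma interior_max:
  assumes "0 \<le> p" "p < m" "m < q" and max: "\<And>y. p \<le> y \<Longrightarrow> y \<le> q \<Longrightarrow> h y \<le> h m"
  shows "h' m = 0" and "(6 / m\<^sup>2 + G (h m)) * h m \<le> 0"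
proof -
  define e where "e = min (m - p) (q - m)"
  have e: "e > 0" and sub: "\<bar>y - m\<bar> < e \<Longrightarrow> p < y \<and> y < q" for y
    using assms by (auto simp: e_def)
  have d: "\<bar>y - m\<bar> < e \<Longrightarrow> (h has_real_derivative h' y) (at y)" for y
    using sub[of y] assms(1) deriv_h by force
  have d': "(h' has_real_derivative h'' m) (at m)" using deriv_h' assms by simp
  have le: "\<bar>y - m\<bar> < e \<Longrightarrow> h y \<le> h m" for y using sub[of y] max[of y] by linarith
  note * = second_derivative_at_local_max[OF e d d' le]
  show "h' m = 0" by (rule *(1))
  then show "(6 / m\<^sup>2 + G (h m)) * h m \<le> 0" using *(2) h''_eq[of m] assms by simp
qed

lemma interior_min:
  assumes "0 \<le> p" "p < m" "m < q" and min: "\<And>y. p \<le> y \<Longrightarrow> y \<le> q \<Longrightarrow> h m \<le> h y"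
  shows "h' m = 0" and "(6 / m\<^sup>2 + G (h m)) * h m \<ge> 0"
proof -
  define e where "e = min (m - p) (q - m)"
  have e: "e > 0" and sub: "\<bar>y - m\<bar> < e \<Longrightarrow> p < y \<and> y < q" for y
    using assms by (auto simp: e_def)
  have d: "\<bar>y - m\<bar> < e \<Longrightarrow> (h has_real_derivative h' y) (at y)" for y
    using sub[of y] assms(1) deriv_h by force
  have d': "(h' has_real_derivative h'' m) (at m)" using deriv_h' assms by simp
  have ge: "\<bar>y - m\<bar> < e \<Longrightarrow> h m \<le> h y" for y using sub[of y] min[of y] by linarith
  note * = second_derivative_at_local_min[OF e d d' ge]
  show "h' m = 0" by (rule *(1))
  then show "(6 / m\<^sup>2 + G (h m)) * h m \<ge> 0" using *(2) h''_eq[of m] assms by simp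
qed

text \<open>Maximum principle: a value above 1 forces an interior maximum above 1, where
  \<open>G\<close> is positive, being increasing past its root 1.\<close>

lemma le_1: "r \<ge> 0 \<Longrightarrow> h r \<le> 1"
proof (rule ccontr)
  assume r: "r \<ge> 0" "\<not> h r \<le> 1"
  then have "eventually (\<lambda>R. h R < h r \<and> R > r) at_top"
    using limit by (intro eventually_conj order_tendstoD eventually_gt_at_top) auto
  then obtain R where R: "h R < h r" "R > r" by (auto simp: eventually_at_top_linorder)
  obtain m where m: "0 \<le> m" "m \<le> R" "\<And>y. 0 \<le> y \<Longrightarrow> y \<le> R \<Longrightarrow> h y \<le> h m"
    using continuous_attains_sup[of "{0..R}" h] continuous_on_h[of R] r R by fastforce
  have hm: "h m > 1" using m(3)[of r] r R by auto
  have "m \<noteq> R" using m(3)[of r] r R by auto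
  moreover have "m \<noteq> 0" using hm zero by auto
  ultimately have "(6 / m\<^sup>2 + G (h m)) * h m \<le> 0"
    using interior_max(2)[of 0 m R] m by auto
  moreover have "G (h m) > G 1" using hm a_pos by (intro G_strict_mono_above) (auto simp: G_def)
  then have "G (h m) > 0" by (simp add: G_def)
  then have "6 / m\<^sup>2 + G (h m) > 0" by (intro add_nonneg_pos) auto
  ultimately show False using hm by (simp add: mult_le_0_iff)
qed

text \<open>Zeros are excluded by unique continuation towards infinity (Gronwall for \<open>h\<^sup>2 + h'\<^sup>2\<close>).\<close>

lemma pos:
  assumes "r > 0"
  shows "h r > 0"
proof (rule ccontr)
  assume "\<not> h r > 0"
  then have h0: "h r = 0" using nonneg[of r] assms by simp
  have h'0: "h' r = 0"
    using interior_min(1)[of 0 r "r + 1"] assms nonneg h0 by auto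
  \<comment> \<open>\<open>K\<close> bounds \<open>\<bar>1 + 6 / x^2 + G (h x)\<bar>\<close> for all
    \<open>x \<ge> r\<close>, with room to spare.\<close>
  define K where "K = 6 / r\<^sup>2 + 3"
  define E where "E s = ((h s)\<^sup>2 + (h' s)\<^sup>2) * exp (- K * s)" for s
  have "h s = 0" if "s > r" for s
  proof -
    have "E s \<le> E r"
    proof (rule DERIV_nonpos_imp_nonincreasing[of r s E])
      show "r \<le> s" using that by simp
      fix x assume "r \<le> x" "x \<le> s"
      then have x: "x > 0" using assms by simp
      let ?c = "6 / x\<^sup>2 + G (h x)"
      let ?D = "(2 * h x * h' x + 2 * h' x * h'' x - K * ((h x)\<^sup>2 + (h' x)\<^sup>2)) * exp (- K * x)"
      have "(E has_real_derivative ?D) (at x)"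
        unfolding E_def
        by (rule derivative_eq_intros refl deriv_h[OF x] deriv_h'[OF x])+ (simp add: algebra_simps)
      moreover have "?D \<le> 0"
      proof -
        have "6 / x\<^sup>2 \<le> 6 / r\<^sup>2"
          using \<open>r \<le> x\<close> assms by (intro divide_left_mono power_mono mult_pos_pos) auto
        moreover have "6 / x\<^sup>2 \<ge> 0" by simp
        moreover have "G (h x) \<le> 0" using G_le_0 nonneg le_1 x by simp
        ultimately have c: "\<bar>1 + ?c\<bar> \<le> K"
          using G_ge[of "h x"] unfolding K_def by linarith
        have "2 * h x * h' x + 2 * h' x * h'' x
            = (1 + ?c) * (2 * h x * h' x) - 4 / x * (h' x)\<^sup>2"
          unfolding h''_eq[OF x] by (simp add: algebra_simps power2_eq_square)
        \<comment> \<open>The damping term has the favourable sign when moving outwards.\<close>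
        also have "\<dots> \<le> (1 + ?c) * (2 * h x * h' x)" using x by simp
        also have "\<dots> \<le> \<bar>1 + ?c\<bar> * \<bar>2 * h x * h' x\<bar>" by (metis abs_ge_self abs_mult)
        also have "\<dots> \<le> K * ((h x)\<^sup>2 + (h' x)\<^sup>2)"
        proof (rule mult_mono[OF c])
          have "0 \<le> (h x - h' x)\<^sup>2" "0 \<le> (h x + h' x)\<^sup>2" by auto
          then show "\<bar>2 * h x * h' x\<bar> \<le> (h x)\<^sup>2 + (h' x)\<^sup>2"
            by (simp add: power2_eq_square algebra_simps abs_le_iff)
        qed (use c in auto)
        finally show ?thesis by (simp add: mult_le_0_iff)
      qed
      ultimately show "\<exists>y. (E has_real_derivative y) (at x) \<and> y \<le> 0" by blast
    qed
    then have "(h s)\<^sup>2 + (h' s)\<^sup>2 \<le> 0" using h0 h'0 by (simp add: E_def mult_le_0_iff)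
    then show ?thesis by (simp add: sum_power2_le_zero_iff)
  qed
  then have "eventually (\<lambda>s. h s = 0) at_top"
    by (meson eventually_gt_at_top eventually_mono)
  moreover have "eventually (\<lambda>s. h s > 0) at_top" using limit by (rule order_tendstoD) simp
  ultimately have "eventually (\<lambda>s::real. False) at_top" by eventually_elim simp
  then show False by simp
qed

text \<open>
  With \<open>W = r\<^sup>2 (h' w - h w')\<close> one has \<open>W' = r\<^sup>4 h (14 / 13 + G h (1 - r\<^sup>2 / 13)) \<ge> 0\<close>; a negative
  value of \<open>W\<close> would therefore persist down to the origin and make \<open>h\<close> decrease from \<open>h 0 = 0\<close>.
\<close>

lemma h'_pos_near_0:
  assumes "r > 0" "r\<^sup>2 \<le> 6"
  shows "h' r > 0"
proof -
  define w where "w s = s\<^sup>2 - s ^ 4 / 13" for s :: real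
  define w' where "w' s = 2 * s - 4 * s ^ 3 / 13" for s :: real
  define W where "W s = s\<^sup>2 * (h' s * w s - h s * w' s)" for s
  have w_pos: "w s > 0" "w' s > 0" if "0 < s" "s \<le> r" for s
  proof -
    have "s\<^sup>2 \<le> 6" using power_mono[of s r 2] that assms by linarith
    \<comment> \<open>The first positive zero of \<open>w'\<close> is at
      \<open>s^2 = 13 / 2\<close>, just beyond the range needed.\<close>
    then have "s\<^sup>2 * (1 - s\<^sup>2 / 13) > 0" "2 * s * (1 - 2 * s\<^sup>2 / 13) > 0"
      using that by auto
    then show "w s > 0" "w' s > 0"
      by (simp_all add: w_def w'_def algebra_simps power2_eq_square power3_eq_cube power4_eq_xxxx)
  qed
  have deriv_w: "(w has_real_derivative w' x) (at x)" for x
    unfolding w_def w'_def by (auto intro!: derivative_eq_intros)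
  have deriv_w': "(w' has_real_derivative 2 - 12 * x\<^sup>2 / 13) (at x)" for x
    unfolding w'_def by (auto intro!: derivative_eq_intros)
  have W_mono: "W s \<le> W r" if s: "0 < s" "s \<le> r" for s
  proof (rule DERIV_nonneg_imp_nondecreasing[of s r W])
    show "s \<le> r" by (rule s(2))
    fix x assume x: "s \<le> x" "x \<le> r"
    then have x0: "x > 0" using s by simp
    have x6: "x\<^sup>2 \<le> 6" using power_mono[of x r 2] x x0 assms by linarith
    let ?D = "2 * x * (h' x * w x - h x * w' x) + x\<^sup>2 * (h'' x * w x - h x * (2 - 12 * x\<^sup>2 / 13))"
    have "(W has_real_derivative ?D) (at x)"
      unfolding W_def
      by (rule derivative_eq_intros refl deriv_h[OF x0] deriv_h'[OF x0] deriv_w deriv_w')+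
        (simp add: algebra_simps)
    \<comment> \<open>Since \<open>w'' + 2 * w' / x - 6 * w / x^2 = - (14 / 13) * x^2\<close>, the
      singular terms and those in \<open>h'\<close> cancel.\<close>
    moreover have "?D = x ^ 4 * h x * (14 / 13 + G (h x) * (1 - x\<^sup>2 / 13))"
    proof -
      have eq: "x\<^sup>2 * h'' x = (6 + x\<^sup>2 * G (h x)) * h x - 2 * x * h' x"
        unfolding h''_eq[OF x0] using x0 by (simp add: field_simps power2_eq_square)
      have "?D = w x * (x\<^sup>2 * h'' x) + 2 * x * (h' x * w x - h x * w' x)
          - h x * (2 * x\<^sup>2 - 12 * x ^ 4 / 13)"
        by (simp add: algebra_simps power2_eq_square power4_eq_xxxx)
      then show ?thesis unfolding eq w_def w'_def
        by (simp add: algebra_simps power2_eq_square power3_eq_cube power4_eq_xxxx)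
    qed
    moreover have "14 / 13 + G (h x) * (1 - x\<^sup>2 / 13) \<ge> 0"
    proof -
      have "- (14 / 13) * 1 \<le> - (14 / 13) * (1 - x\<^sup>2 / 13)" by simp
      also have "\<dots> \<le> G (h x) * (1 - x\<^sup>2 / 13)" using G_ge x6 by (intro mult_right_mono) auto
      finally show ?thesis by simp
    qed
    ultimately show "\<exists>y. (W has_real_derivative y) (at x) \<and> 0 \<le> y"
      using nonneg[of x] x0 by (intro exI[of _ ?D]) auto
  qed
  have "W r \<ge> 0"
  proof (rule ccontr)
    assume neg: "\<not> W r \<ge> 0"
    \<comment> \<open>Nothing is known about \<open>h'\<close> near 0, so only the part of
      \<open>W\<close> without it is passed to the limit; the mean value theorem then supplies a
      point where \<open>h'\<close> is \<open>h c / c\<close>.\<close>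
    have "((\<lambda>s. s\<^sup>2 * (h s * w' s)) \<longlongrightarrow> 0\<^sup>2 * (h 0 * w' 0)) (at_right 0)"
      unfolding w'_def by (intro tendsto_intros right_cont) auto
    then have "eventually (\<lambda>s. s\<^sup>2 * (h s * w' s) < - W r) (at_right 0)"
      using neg by (intro order_tendstoD(2)) auto
    then obtain b where b: "b > 0" "\<And>s. 0 < s \<Longrightarrow> s < b \<Longrightarrow> s\<^sup>2 * (h s * w' s) < - W r"
      by (auto simp: eventually_at_right_field)
    define c where "c = min b r / 2"
    have c: "0 < c" "c < b" "c < r" using b assms by (auto simp: c_def)
    have "\<exists>z. c > z \<and> z > 0 \<and> h c - h 0 = (c - 0) * h' z"
    proof -
      have "\<exists>l z. 0 < z \<and> z < c \<and> DERIV h z :> l \<and> h c - h 0 = (c - 0) * l"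
        using c continuous_on_h deriv_h by (intro MVT) (auto simp: real_differentiable_def)
      then show ?thesis using DERIV_unique deriv_h by blast
    qed
    then obtain z where z: "0 < z" "z < c" "h c = c * h' z" using zero by auto
    have "z\<^sup>2 * (h' z * w z) = W z + z\<^sup>2 * (h z * w' z)" by (simp add: W_def algebra_simps)
    also have "\<dots> < 0" using W_mono[of z] b(2)[of z] z c by auto
    finally have "h' z < 0" using w_pos(1)[of z] z c by (simp add: mult_less_0_iff)
    then have "h c < 0" using z c by (simp add: mult_less_0_iff)
    then show False using nonneg[of c] c by simp
  qed
  then have "h' r * w r \<ge> h r * w' r" using assms by (simp add: W_def zero_le_mult_iff)
  moreover have "h r * w' r > 0" using pos w_pos assms by simp
  ultimately show ?thesis using w_pos(1)[of r] assms
    by (smt (verit) mult_nonpos_nonneg)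
qed

section \<open>Monotonicity\<close>

lemma mono:
  assumes "0 < x" "x < y"
  shows "h x \<le> h y"
proof (rule ccontr)
  assume "\<not> h x \<le> h y"
  then have less: "h y < h x" by simp
  obtain r1 where r1: "0 \<le> r1" "r1 \<le> y" "\<And>s. 0 \<le> s \<Longrightarrow> s \<le> y \<Longrightarrow> h s \<le> h r1"
    using continuous_attains_sup[of "{0..y}" h] continuous_on_h[of y] assms by fastforce
  have h1: "h r1 > h y" using r1(3)[of x] less assms by simp
  have "r1 \<noteq> y" using h1 by auto
  moreover have "r1 \<noteq> 0" using h1 zero nonneg[of y] assms by auto
  ultimately have r1y: "0 < r1" "r1 < y" using r1 by auto
  have max: "(6 / r1\<^sup>2 + G (h r1)) * h r1 \<le> 0"
    using interior_max(2)[of 0 r1 y] r1y r1(3) by simp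
  have "h y < 1" using less le_1[of x] assms by simp
  \<comment> \<open>Such an \<open>R\<close> keeps the minimum over \<open>{r1..R}\<close> away from
    the right end.\<close>
  then have "eventually (\<lambda>R. h y < h R \<and> y < R) at_top"
    using limit by (intro eventually_conj order_tendstoD eventually_gt_at_top)
  then obtain R where R: "h y < h R" "y < R" by (auto simp: eventually_at_top_linorder)
  have "continuous_on {r1..R} h"
    by (rule continuous_on_subset[OF continuous_on_h[of R]]) (use r1y in auto)
  then obtain r2 where r2: "r1 \<le> r2" "r2 \<le> R" "\<And>s. r1 \<le> s \<Longrightarrow> s \<le> R \<Longrightarrow> h r2 \<le> h s"
    using continuous_attains_inf[of "{r1..R}" h] r1y R by fastforce
  have h2: "h r2 \<le> h y" using r2(3)[of y] r1y R by simp
  have "r2 \<noteq> r1" "r2 \<noteq> R" using h2 h1 R by auto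
  then have r12: "r1 < r2" "r2 < R" using r2 by auto
  have crit: "h' r2 = 0" and min: "(6 / r2\<^sup>2 + G (h r2)) * h r2 \<ge> 0"
    using interior_min[of r1 r2 R] r1y r12 r2(3) by auto
  have r2_gt: "r2\<^sup>2 > 6" using h'_pos_near_0[of r2] crit r12 r1y by force
  have "6 / r2\<^sup>2 + G (h r2) \<ge> 0" "6 / r1\<^sup>2 + G (h r1) \<le> 0"
    using min max pos[of r1] pos[of r2] r1y r12 by (auto simp: zero_le_mult_iff mult_le_0_iff)
  moreover have "6 / r2\<^sup>2 < 6 / r1\<^sup>2"
    using r1y r12 by (intro divide_strict_left_mono power_strict_mono mult_pos_pos) auto
  moreover have "6 / r2\<^sup>2 < 1" using r2_gt by (subst divide_less_eq_1_pos) linarith+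
  moreover have "h r2 < h r1" "h r2 \<ge> 0" using h1 h2 nonneg[of r2] r1y r12 by auto
  ultimately show False using G_strict_mono_above[of "h r2" "h r1"] by linarith
qed

text \<open>Every interior point of a plateau is both a maximum and a minimum, so
  \<open>6 / s^2\<close> would have to equal the constant \<open>- G (h x)\<close> throughout; two
  points refute this.\<close>

lemma strict_mono:
  assumes "0 < x" "x < y"
  shows "h x < h y"
proof (rule ccontr)
  assume "\<not> h x < h y"
  then have eq: "h x = h y" using mono[OF assms] by simp
  have const: "h s = h x" if "x \<le> s" "s \<le> y" for s
  proof (rule antisym)
    show "h s \<le> h x" using mono[of s y] that assms eq by (cases "s = y") auto
    show "h x \<le> h s" using mono[of x s] that assms by (cases "s = x") auto
  qed
  have G_eq: "6 / s\<^sup>2 + G (h x) = 0" if s: "x < s" "s < y" for s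
  proof -
    have eqs: "h u = h s" if "x \<le> u" "u \<le> y" for u
      using const[of u] const[of s] that s by simp
    have "(6 / s\<^sup>2 + G (h s)) * h s \<le> 0"
      by (rule interior_max(2)[of x s y]) (use s assms in \<open>auto dest: eqs\<close>)
    moreover have "(6 / s\<^sup>2 + G (h s)) * h s \<ge> 0"
      by (rule interior_min(2)[of x s y]) (use s assms in \<open>auto dest: eqs\<close>)
    moreover have "h s = h x" using s by (intro const) auto
    ultimately show ?thesis using pos[OF assms(1)] by simp
  qed
  define p q where "p = (2 * x + y) / 3" and "q = (x + 2 * y) / 3"
  have pq: "x < p" "p < q" "q < y" using assms by (auto simp: p_def q_def)
  then have "6 / q\<^sup>2 < 6 / p\<^sup>2"
    using assms by (intro divide_strict_left_mono power_strict_mono mult_pos_pos) auto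
  then show False using G_eq[of p] G_eq[of q] pq by simp
qed

end

theorem proposition4p2:
  "\<exists>t0::real. t0 > 1 \<and>
     (\<forall>t\<ge>t0. \<forall>h. hedgehog_profile t h \<longrightarrow> strict_mono_on {0<..} h)"
proof (intro exI[of _ 27] conjI allI impI)
  fix t :: real and h assume t: "t \<ge> 27" and "hedgehog_profile t h"
  then obtain h' h'' where "hedgehog (3 * h_plus t / t) h h' h''"
    unfolding hedgehog_profile_def hedgehog_def using coupling_bounds[OF t] by blast
  then interpret hedgehog "3 * h_plus t / t" h h' h'' .
  show "strict_mono_on {0<..} h" by (auto intro!: strict_mono_onI strict_mono)
qed simp

end
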